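(* Let $W$ be the $\widetilde A_3$ Euclidean group, i.e. the Coxeter group with generating set $S=\{p,r,s,t\}$ and $m_{pr}=m_{rs}=m_{st}=m_{tp}=3$, $m_{ps}=m_{rt}=2$. Then its standard language $\mathcal L\subset S^*$ does not satisfy part (ii) of the definition of biautomaticity; that is, there is no constant $C>0$ such that for each $a\in S$ and $g,g'\in W$ with $g'=ga$, and each $v,v'\in\mathcal L$ representing $g,g'$ respectively, we have $\ell(v(i)^{-1}v'(i))\le C$ for all $i\ge 1$.
   Context: A Coxeter group $W$ is a group generated by a finite set $S$ subject only to the relations $s^2=1$ for $s\in S$ and $(st)^{m_{st}}=1$ for $s\neq t\in S$, where $m_{st}=m_{ts}\in\{2,3,\ldots,\infty\}$ and $m_{st}=\infty$ means that no relation is imposed between $s$ and $t$. $\ell(g)$ denotes the word length of $g\in W$ with respect to $S$, and $S^*$ is the set of all words over $S$. For $v\in S^*$ of length $n$, $v(i)$ denotes the prefix of $v$ of length $i$ for $i\le n-1$, and $v(i)=v$ for $i\ge n$; for $1\le i\le j\le n$, $v(i,j)$ denotes the subword of $v(j)$ obtained by removing the prefix $v(i-1)$. For a word $v$, $\ell(v)$ is the word length of the group element represented by $v$. **Standard language.** For $g\in W$ let $T(g)\subseteq S$ be the set of $s\in S$ with $\ell(gs)<\ell(g)$. The group $\langle T(g)\rangle$ is finite; let $w(g)$ be its (unique) longest element, and let $\Pi(g)=gw(g)$. One has $\ell(\Pi(g))+\ell(w(g))=\ell(g)$. The standard language $\mathcal L\subset S^*$ for $W$ is defined inductively: a word $v$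 representing the identity belongs to $\mathcal L$ if and only if it is empty; a word $v$ of length $n$ representing $g\ne\mathrm{id}$ belongs to $\mathcal L$ if and only if, for $k=\ell(w(g))$, we have $v(n-k)\in\mathcal L$ and $v(n-k+1,n)$ represents $w(g)$. *)

theory Defs
  imports "HOL-Algebra.Generated_Groups" "HOL-Library.Extended_Nat"
begin

text \<open>
  A Coxeter matrix on the finite generating set \<open>UNIV :: 's set\<close>; its diagonal is never used.
  Since every generator is an involution, the group presented by the Coxeter relations is the
  quotient of the monoid of words \<open>'s list\<close> (no formal inverses are needed) by the congruence
  generated by the relations.
\<close>

definition coxeter_matrix :: "('s::finite \<Rightarrow> 's \<Rightarrow> enat) \<Rightarrow> bool" where
  "coxeter_matrix m \<longleftrightarrow> (\<forall>s t. m s t = m t s) \<and> (\<forall>s t. s \<noteq> t \<longrightarrow> 2 \<le> m s t)"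

inductive_set coxeter_rel :: "('s::finite \<Rightarrow> 's \<Rightarrow> enat) \<Rightarrow> ('s list \<times> 's list) set"
  for m :: "'s \<Rightarrow> 's \<Rightarrow> enat" where
  refl: "(u, u) \<in> coxeter_rel m"
| sym: "(u, v) \<in> coxeter_rel m \<Longrightarrow> (v, u) \<in> coxeter_rel m"
| trans: "(u, v) \<in> coxeter_rel m \<Longrightarrow> (v, w) \<in> coxeter_rel m \<Longrightarrow> (u, w) \<in> coxeter_rel m"
| square: "(x @ [s, s] @ y, x @ y) \<in> coxeter_rel m"
| braid: "s \<noteq> t \<Longrightarrow> m s t = enat k \<Longrightarrow>
    (x @ concat (replicate k [s, t]) @ y, x @ y) \<in> coxeter_rel m"

definition word_elt :: "('s::finite \<Rightarrow> 's \<Rightarrow> enat) \<Rightarrow> 's list \<Rightarrow> 's list set" where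
  "word_elt m v = coxeter_rel m `` {v}"

definition coxeter_group :: "('s::finite \<Rightarrow> 's \<Rightarrow> enat) \<Rightarrow> 's list set monoid" where
  "coxeter_group m =
    \<lparr>carrier = UNIV // coxeter_rel m,
     mult = (\<lambda>A B. \<Union>u\<in>A. \<Union>v\<in>B. word_elt m (u @ v)),
     one = word_elt m []\<rparr>"

lemma equiv_coxeter_rel: "equiv UNIV (coxeter_rel m)"
proof (intro equivI refl_onI symI transI)
  show "coxeter_rel m \<subseteq> UNIV \<times> UNIV" by simp
qed (erule (1) coxeter_rel.trans | erule coxeter_rel.sym | rule coxeter_rel.refl)+

lemma word_elt_eq_iff: "word_elt m u = word_elt m v \<longleftrightarrow> (u, v) \<in> coxeter_rel m"
  unfolding word_elt_def by (rule eq_equiv_class_iff[OF equiv_coxeter_rel]) simp_all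

lemma coxeter_rel_context:
  "(u, v) \<in> coxeter_rel m \<Longrightarrow> (a @ u @ b, a @ v @ b) \<in> coxeter_rel m"
proof (induction rule: coxeter_rel.induct)
  case (refl u)
  show ?case by (rule coxeter_rel.refl)
next
  case (sym u v)
  show ?case by (rule coxeter_rel.sym[OF sym.IH])
next
  case (trans u v w)
  show ?case by (rule coxeter_rel.trans[OF trans.IH])
next
  case (square x s y)
  show ?case using coxeter_rel.square[of "a @ x" s "y @ b" m] by simp
next
  case (braid s t k x y)
  then show ?case using coxeter_rel.braid[of s t m k "a @ x" "y @ b"] by simp
qed

lemma coxeter_rel_append:
  assumes "(u, u') \<in> coxeter_rel m" and "(v, v') \<in> coxeter_rel m"
  shows "(u @ v, u' @ v') \<in> coxeter_rel m"
proof (rule coxeter_rel.trans)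
  show "(u @ v, u' @ v) \<in> coxeter_rel m"
    using coxeter_rel_context[OF assms(1), of "[]" v] by simp
  show "(u' @ v, u' @ v') \<in> coxeter_rel m"
    using coxeter_rel_context[OF assms(2), of u' "[]"] by simp
qed

lemma carrier_coxeter_group: "carrier (coxeter_group m) = range (word_elt m)"
  by (auto simp: coxeter_group_def word_elt_def quotient_def)

lemma one_coxeter_group: "\<one>\<^bsub>coxeter_group m\<^esub> = word_elt m []"
  by (simp add: coxeter_group_def)

lemma mult_word_elt: "word_elt m u \<otimes>\<^bsub>coxeter_group m\<^esub> word_elt m v = word_elt m (u @ v)"
proof -
  have "word_elt m (u' @ v') = word_elt m (u @ v)"
    if "u' \<in> word_elt m u" "v' \<in> word_elt m v" for u' v'
  proof -
    have "(u @ v, u' @ v') \<in> coxeter_rel m"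
      using that by (intro coxeter_rel_append) (simp_all add: word_elt_def)
    then show ?thesis by (simp add: word_elt_eq_iff coxeter_rel.sym)
  qed
  moreover have "u \<in> word_elt m u" "v \<in> word_elt m v"
    by (simp_all add: word_elt_def coxeter_rel.refl)
  ultimately have "(\<Union>u'\<in>word_elt m u. \<Union>v'\<in>word_elt m v. word_elt m (u' @ v')) = word_elt m (u @ v)"
    by blast
  then show ?thesis by (simp add: coxeter_group_def)
qed

lemma rev_word_inverse: "(rev v @ v, []) \<in> coxeter_rel m"
proof (induction v)
  case (Cons s v)
  then show ?case
    using coxeter_rel.trans[OF coxeter_rel.square[of "rev v" s v m]] by simp
qed (simp add: coxeter_rel.refl)

lemma group_coxeter_group: "group (coxeter_group m)"
proof (rule groupI)
  fix g assume "g \<in> carrier (coxeter_group m)"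
  then obtain v where "g = word_elt m v" by (auto simp: carrier_coxeter_group)
  then show "\<exists>h\<in>carrier (coxeter_group m). h \<otimes>\<^bsub>coxeter_group m\<^esub> g = \<one>\<^bsub>coxeter_group m\<^esub>"
    by (intro bexI[of _ "word_elt m (rev v)"])
      (auto simp: carrier_coxeter_group one_coxeter_group mult_word_elt word_elt_eq_iff
        rev_word_inverse)
qed (auto simp: carrier_coxeter_group one_coxeter_group mult_word_elt)

definition cox_length :: "('s::finite \<Rightarrow> 's \<Rightarrow> enat) \<Rightarrow> 's list set \<Rightarrow> nat" where
  "cox_length m g = (LEAST n. \<exists>v. length v = n \<and> word_elt m v = g)"

definition right_descents :: "('s::finite \<Rightarrow> 's \<Rightarrow> enat) \<Rightarrow> 's list set \<Rightarrow> 's set" where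
  "right_descents m g =
    {s. cox_length m (g \<otimes>\<^bsub>coxeter_group m\<^esub> word_elt m [s]) < cox_length m g}"

text \<open>
  The subgroup generated by the right descents of \<open>g\<close> is a finite Coxeter group, so it has
  exactly one element of maximal length and the choice made by \<open>ARG_MAX\<close> is no choice at all.
\<close>

definition longest_suffix :: "('s::finite \<Rightarrow> 's \<Rightarrow> enat) \<Rightarrow> 's list set \<Rightarrow> 's list set" where
  "longest_suffix m g =
    (ARG_MAX (cox_length m) h.
       h \<in> generate (coxeter_group m) ((\<lambda>s. word_elt m [s]) ` right_descents m g))"

text \<open>
  For a word \<open>v\<close> representing \<open>g \<noteq> 1\<close> the longest element of the descent subgroup has length
  \<open>k\<close> with \<open>1 \<le> k \<le> length v\<close>. So the subtraction below does not truncate, and the recursion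
  is on a strictly shorter prefix: the least fixed point is the only language satisfying the
  defining equivalence.
\<close>

inductive_set standard_language :: "('s::finite \<Rightarrow> 's \<Rightarrow> enat) \<Rightarrow> 's list set"
  for m :: "'s \<Rightarrow> 's \<Rightarrow> enat" where
  empty: "[] \<in> standard_language m"
| step: "\<lbrakk>word_elt m v = g; g \<noteq> \<one>\<^bsub>coxeter_group m\<^esub>;
     k = cox_length m (longest_suffix m g);
     take (length v - k) v \<in> standard_language m;
     word_elt m (drop (length v - k) v) = longest_suffix m g\<rbrakk>
    \<Longrightarrow> v \<in> standard_language m"

datatype a3_gen = gen_p | gen_r | gen_s | gen_t

instance a3_gen :: finite
proof
  have "x \<in> {gen_p, gen_r, gen_s, gen_t}" for x
    by (cases x) simp_all
  then have "UNIV \<subseteq> {gen_p, gen_r, gen_s, gen_t}" by (intro subsetI)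
  then show "finite (UNIV :: a3_gen set)" by (rule finite_subset) simp
qed

definition affine_A3 :: "a3_gen \<Rightarrow> a3_gen \<Rightarrow> enat" where
  "affine_A3 x y =
    (if x = y then 1
     else if {x, y} \<in> {{gen_p, gen_r}, {gen_r, gen_s}, {gen_s, gen_t}, {gen_t, gen_p}} then 3
     else 2)"

lemma coxeter_matrix_affine_A3: "coxeter_matrix affine_A3"
  by (auto simp: coxeter_matrix_def affine_A3_def insert_commute)

end

theory Submission
  imports Defs
begin

text \<open>
  Write \<open>A = rtsrtp\<close>, \<open>B = rtps\<close> and \<open>D = stsrpr\<close>. In the group \<open>A\<close> commutes with \<open>B\<^sup>2\<close> and
  \<open>A r = r D\<close>, so \<open>A\<^sup>j B\<^sup>2\<^sup>k r = B\<^sup>2\<^sup>k r D\<^sup>j\<close>. Both \<open>A\<^sup>j B\<^sup>2\<^sup>k\<close> and \<open>B\<^sup>2\<^sup>k r D\<^sup>j\<close> are standard words, and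
  they represent neighbouring elements, but one sets out in the direction of the translation \<open>A\<close>
  and the other in that of the translation \<open>B\<^sup>2\<close>. Lengths are bounded from below through the
  action of the group on affine permutations by inversion counting. Its faithfulness is never
  needed, because each upper bound for a length comes from an explicit word.
\<close>

section \<open>Reduced words and descents\<close>

lemma cox_length_le: "cox_length m (word_elt m v) \<le> length v"
  unfolding cox_length_def by (rule Least_le) blast

lemma cox_length_attained:
  obtains u where "length u = cox_length m (word_elt m v)" "(u, v) \<in> coxeter_rel m"
proof -
  have "\<exists>n u. length u = n \<and> word_elt m u = word_elt m v" by blast
  from LeastI_ex[OF this] obtain u
    where "length u = cox_length m (word_elt m v)" "word_elt m u = word_elt m v"
    unfolding cox_length_def by blast
  then show thesis using that by (simp add: word_elt_eq_iff)
qed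

definition reduced :: "('s::finite \<Rightarrow> 's \<Rightarrow> enat) \<Rightarrow> 's list \<Rightarrow> bool" where
  "reduced m v \<longleftrightarrow> cox_length m (word_elt m v) = length v"

text \<open>A shorter word for the suffix would also shorten the whole word.\<close>

lemma reduced_suffix:
  assumes "reduced m (u @ w)"
  shows "reduced m w"
proof -
  obtain w' where w': "length w' = cox_length m (word_elt m w)" "(w', w) \<in> coxeter_rel m"
    by (rule cox_length_attained)
  then have "word_elt m (u @ w') = word_elt m (u @ w)"
    by (simp add: word_elt_eq_iff coxeter_rel_append coxeter_rel.refl)
  then have "length (u @ w) \<le> length (u @ w')"
    using assms cox_length_le[of m "u @ w'"] by (simp add: reduced_def)
  then show ?thesis
    using w'(1) cox_length_le[of m w] by (simp add: reduced_def)
qed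

text \<open>Descents are certified by an equally long word ending in \<open>s\<close>;
  \<open>not_right_descent_if_reduced\<close> excludes them by a reduced extension.\<close>

lemma right_descent_if_final_letter:
  assumes "reduced m v" "(v, v' @ [s]) \<in> coxeter_rel m" "length v = Suc (length v')"
  shows "s \<in> right_descents m (word_elt m v)"
proof -
  have "((v' @ [s]) @ [s], v') \<in> coxeter_rel m"
    using coxeter_rel.square[of v' s "[]" m] by simp
  then have "(v @ [s], v') \<in> coxeter_rel m"
    by (rule coxeter_rel.trans[OF coxeter_rel_append[OF assms(2) coxeter_rel.refl]])
  then have "cox_length m (word_elt m (v @ [s])) \<le> length v'"
    using cox_length_le[of m v'] by (simp add: word_elt_eq_iff[symmetric])
  then show ?thesis
    using assms(1,3) by (simp add: right_descents_def mult_word_elt reduced_def)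
qed

lemma not_right_descent_if_reduced:
  assumes "reduced m (v @ [s])"
  shows "s \<notin> right_descents m (word_elt m v)"
  using assms cox_length_le[of m v]
  by (simp add: right_descents_def mult_word_elt reduced_def)

text \<open>A set \<open>F\<close> of words that contains the empty word and is closed under right
  multiplication by descents covers the whole descent subgroup. Since \<open>w\<close> is reduced
  and every other word of \<open>F\<close> is shorter, \<open>w\<close> is the unique maximum, so
  \<open>ARG_MAX\<close> has to select it.\<close>

lemma longest_suffix_eqI:
  assumes "[] \<in> F" "w \<in> F"
    and closed: "\<And>u s. u \<in> F \<Longrightarrow> s \<in> right_descents m g \<Longrightarrow> \<exists>u'\<in>F. (u @ [s], u') \<in> coxeter_rel m"
    and w: "set w \<subseteq> right_descents m g" "reduced m w"
    and shorter: "\<And>u. u \<in> F \<Longrightarrow> u \<noteq> w \<Longrightarrow> length u < length w"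
  shows "longest_suffix m g = word_elt m w"
proof -
  let ?G = "coxeter_group m"
  let ?H = "generate ?G ((\<lambda>s. word_elt m [s]) ` right_descents m g)"
  interpret group ?G by (rule group_coxeter_group)
  have inv_gen: "inv\<^bsub>?G\<^esub> word_elt m [s] = word_elt m [s]" for s
    by (rule inv_equality)
      (use coxeter_rel.square[of "[]" s "[]" m] in
        \<open>auto simp: mult_word_elt one_coxeter_group word_elt_eq_iff carrier_coxeter_group\<close>)
  have gens: "(\<lambda>s. word_elt m [s]) ` right_descents m g \<subseteq> carrier ?G"
    by (auto simp: carrier_coxeter_group)
  have mult_F: "f \<otimes>\<^bsub>?G\<^esub> word_elt m [s] \<in> word_elt m ` F"
    if f: "f \<in> word_elt m ` F" and s: "s \<in> right_descents m g" for f s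
  proof -
    from f obtain u where u: "u \<in> F" "f = word_elt m u" by blast
    from closed[OF u(1) s] obtain u' where "u' \<in> F" "(u @ [s], u') \<in> coxeter_rel m" by blast
    then show ?thesis by (auto simp: u(2) mult_word_elt word_elt_eq_iff)
  qed
  have F_carrier: "word_elt m ` F \<subseteq> carrier ?G"
    by (auto simp: carrier_coxeter_group)
  \<comment> \<open>Quantifying over all \<open>f\<close> lets the induction pass through products;
    inverses cause no trouble because generators are involutions. Membership in the image of
    \<open>F\<close> follows by taking \<open>f\<close> to be the identity.\<close>
  have H_acts: "\<forall>f\<in>word_elt m ` F. f \<otimes>\<^bsub>?G\<^esub> h \<in> word_elt m ` F" if "h \<in> ?H" for h
    using that
  proof (induction rule: generate.induct)
    case one
    then show ?case using F_carrier by auto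
  next
    case (incl h)
    then show ?case using mult_F by auto
  next
    case (inv h)
    then show ?case using mult_F by (auto simp: inv_gen)
  next
    case (eng h1 h2)
    have "h1 \<in> carrier ?G" "h2 \<in> carrier ?G"
      using eng.hyps generate_incl[OF gens] by auto
    then show ?case
      using eng.IH F_carrier by (auto simp: m_assoc[symmetric] subset_iff)
  qed
  have H_F: "h \<in> word_elt m ` F" if "h \<in> ?H" for h
  proof -
    have "h \<in> carrier ?G" using that generate_incl[OF gens] by auto
    then show ?thesis
      using H_acts[OF that] \<open>[] \<in> F\<close> by (metis image_eqI l_one one_coxeter_group)
  qed
  have "word_elt m v \<in> ?H" if "set v \<subseteq> right_descents m g" for v
    using that
  proof (induction v)
    case Nil
    then show ?case by (metis generate.one one_coxeter_group)
  next
    case (Cons s v)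
    then have "word_elt m [s] \<otimes>\<^bsub>?G\<^esub> word_elt m v \<in> ?H"
      by (intro generate.eng[OF generate.incl]) auto
    then show ?case by (simp add: mult_word_elt)
  qed
  then have w_H: "word_elt m w \<in> ?H" using w(1) .
  have less: "cox_length m h < cox_length m (word_elt m w)" if "h \<in> ?H" "h \<noteq> word_elt m w" for h
  proof -
    obtain u where u: "u \<in> F" "h = word_elt m u" using H_F \<open>h \<in> ?H\<close> by blast
    then have "length u < length w" using that(2) shorter by blast
    then show ?thesis
      using u(2) w(2) cox_length_le[of m u] by (simp add: reduced_def)
  qed
  show ?thesis
    unfolding longest_suffix_def
  proof (rule arg_maxI)
    show "word_elt m w \<in> ?H" by (rule w_H)
    show "\<not> cox_length m (word_elt m w) < cox_length m h" if "h \<in> ?H" for h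
      using less[OF that] by (cases "h = word_elt m w") auto
    show "h = word_elt m w"
      if "h \<in> ?H" "\<forall>y. y \<in> ?H \<longrightarrow> \<not> cox_length m h < cox_length m y" for h
      using that less w_H by blast
  qed
qed

text \<open>Since \<open>w\<close> is reduced, the length of the longest suffix is exactly
  \<open>length w\<close>, so the recursive cut falls between \<open>u\<close> and
  \<open>w\<close>.\<close>

lemma standard_language_append:
  assumes "u \<in> standard_language m" "reduced m (u @ w)" "w \<noteq> []"
    and longest: "longest_suffix m (word_elt m (u @ w)) = word_elt m w"
  shows "u @ w \<in> standard_language m"
proof (rule standard_language.step)
  show "word_elt m (u @ w) \<noteq> \<one>\<^bsub>coxeter_group m\<^esub>"
    using assms(2,3) cox_length_le[of m "[]"] by (auto simp: reduced_def one_coxeter_group)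
  have "cox_length m (word_elt m w) = length w"
    using reduced_suffix[OF assms(2)] by (simp add: reduced_def)
  then show "length w = cox_length m (longest_suffix m (word_elt m (u @ w)))"
    by (simp add: longest)
qed (use assms in simp_all)

section \<open>Relations between words\<close>

lemma coxeter_rel_square: "([s, s], []) \<in> coxeter_rel m"
  using coxeter_rel.square[of "[]" s "[]" m] by simp

text \<open>Shifting letters one at a time to the other side turns a relator \<open>(st)^k\<close>
  into the commutation or braid form of the relation.\<close>

lemma coxeter_rel_move_right:
  assumes "(u @ [s], v) \<in> coxeter_rel m"
  shows "(u, v @ [s]) \<in> coxeter_rel m"
proof (rule coxeter_rel.trans)
  show "(u, u @ [s, s]) \<in> coxeter_rel m"
    using coxeter_rel.sym[OF coxeter_rel.square[of u s "[]" m]] by simp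
  show "(u @ [s, s], v @ [s]) \<in> coxeter_rel m"
    using coxeter_rel_context[OF assms, of "[]" "[s]"] by simp
qed

lemma coxeter_rel_comm:
  assumes "s \<noteq> t" "m s t = 2"
  shows "([s, t], [t, s]) \<in> coxeter_rel m"
proof -
  have "([s, t, s] @ [t], []) \<in> coxeter_rel m"
    using coxeter_rel.braid[of s t m 2 "[]" "[]"] assms by (simp add: numeral_eq_enat numeral_2_eq_2)
  then have "([s, t] @ [s], [] @ [t]) \<in> coxeter_rel m"
    using coxeter_rel_move_right by fastforce
  then show ?thesis using coxeter_rel_move_right by fastforce
qed

lemma coxeter_rel_braid3:
  assumes "s \<noteq> t" "m s t = 3"
  shows "([s, t, s], [t, s, t]) \<in> coxeter_rel m"
proof -
  have "([s, t, s, t, s] @ [t], []) \<in> coxeter_rel m"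
    using coxeter_rel.braid[of s t m 3 "[]" "[]"] assms by (simp add: numeral_eq_enat numeral_3_eq_3)
  then have "([s, t, s, t] @ [s], [t]) \<in> coxeter_rel m"
    using coxeter_rel_move_right by fastforce
  then have "([s, t, s] @ [t], [t, s]) \<in> coxeter_rel m"
    using coxeter_rel_move_right by fastforce
  then show ?thesis using coxeter_rel_move_right by fastforce
qed

section \<open>Powers of words under conjugation and commutation\<close>

abbreviation word_power :: "'a list \<Rightarrow> nat \<Rightarrow> 'a list" where
  "word_power v n \<equiv> concat (replicate n v)"

lemma word_power_Suc_right: "word_power v (Suc n) = word_power v n @ v"
  by (induction n) simp_all

lemma length_word_power: "length (word_power v n) = n * length v"
  by (induction n) simp_all

lemma take_word_power: "k = n * length v \<Longrightarrow> take k (word_power v n @ w) = word_power v n"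
  by (simp add: length_word_power)

lemma coxeter_rel_power_left:
  assumes "(x @ z, z @ y) \<in> coxeter_rel m"
  shows "(word_power x n @ z, z @ word_power y n) \<in> coxeter_rel m"
proof (induction n)
  case (Suc n)
  have "(x @ word_power x n @ z, x @ z @ word_power y n) \<in> coxeter_rel m"
    using coxeter_rel_context[OF Suc, of x "[]"] by simp
  moreover have "(x @ z @ word_power y n, z @ y @ word_power y n) \<in> coxeter_rel m"
    using coxeter_rel_context[OF assms, of "[]" "word_power y n"] by simp
  ultimately show ?case by (auto intro: coxeter_rel.trans)
qed (simp add: coxeter_rel.refl)

text \<open>Commuting means conjugating a word to itself, so \<open>coxeter_rel_power_left\<close>
  applies once for each exponent.\<close>

lemma coxeter_rel_power_comm:
  assumes "(x @ y, y @ x) \<in> coxeter_rel m"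
  shows "(word_power x k @ word_power y n, word_power y n @ word_power x k) \<in> coxeter_rel m"
  by (rule coxeter_rel_power_left,
      rule coxeter_rel.sym, rule coxeter_rel_power_left, rule coxeter_rel.sym, rule assms)

section \<open>Affine permutations\<close>

text \<open>
  The tuple \<open>(x 1, x 2, x 3, x 4)\<close> encodes the bijection \<open>x\<close> of the integers with
  \<open>x (i + 4) = x i + 4\<close>. The generators \<open>gen_r\<close>, \<open>gen_s\<close>, \<open>gen_t\<close>, \<open>gen_p\<close> act on the right
  as the adjacent transpositions of the positions 1, 2, 3, 4.
\<close>

type_synonym window = "int \<times> int \<times> int \<times> int"

fun step :: "window \<Rightarrow> a3_gen \<Rightarrow> window" where
  "step (a, b, c, d) gen_p = (d - 4, b, c, a + 4)"
| "step (a, b, c, d) gen_r = (b, a, c, d)"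
| "step (a, b, c, d) gen_s = (a, c, b, d)"
| "step (a, b, c, d) gen_t = (a, b, d, c)"

text \<open>For \<open>gen_p\<close> the compared positions are 0 and 1; by periodicity the value at
  0 is \<open>d - 4\<close>.\<close>

fun ascent :: "window \<Rightarrow> a3_gen \<Rightarrow> bool" where
  "ascent (a, b, c, d) gen_p \<longleftrightarrow> d - 4 < a"
| "ascent (a, b, c, d) gen_r \<longleftrightarrow> a < b"
| "ascent (a, b, c, d) gen_s \<longleftrightarrow> b < c"
| "ascent (a, b, c, d) gen_t \<longleftrightarrow> c < d"

definition act :: "window \<Rightarrow> a3_gen list \<Rightarrow> window" where
  "act = foldl step"

lemma act_simps [simp]:
  "act x [] = x" "act x (s # v) = act (step x s) v" "act x (u @ v) = act (act x u) v"
  by (simp_all add: act_def)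

lemma act_cong:
  assumes "(u, v) \<in> coxeter_rel affine_A3"
  shows "act x u = act x v"
  using assms
proof (induction arbitrary: x rule: coxeter_rel.induct)
  case (square y s z)
  obtain a b c d where "act x y = (a, b, c, d)" by (cases "act x y")
  then show ?case by (cases s) simp_all
next
  case (braid s t k y z)
  obtain a b c d where "act x y = (a, b, c, d)" by (cases "act x y")
  \<comment> \<open>The exponent is 2 or 3, which leaves finitely many explicit relators to evaluate
    on a symbolic window.\<close>
  moreover have "k = (if affine_A3 s t = 3 then 3 else 2)"
    using braid by (auto simp: affine_A3_def numeral_eq_enat split: if_splits)
  ultimately show ?case
    using braid
    by (cases s; cases t)
      (simp_all add: affine_A3_def doubleton_eq_iff numeral_2_eq_2 numeral_3_eq_3)
qed auto

text \<open>The number of inversions of an affine permutation, by Shi's formula.\<close>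

fun inversions :: "window \<Rightarrow> int" where
  "inversions (a, b, c, d) =
    \<bar>(b - a) div 4\<bar> + \<bar>(c - a) div 4\<bar> + \<bar>(d - a) div 4\<bar> +
    \<bar>(c - b) div 4\<bar> + \<bar>(d - b) div 4\<bar> + \<bar>(d - c) div 4\<bar>"

text \<open>This is the condition for the periodic extension of the window to be a bijection. It
  keeps every difference of two entries away from the multiples of 4.\<close>

fun distinct_residues :: "window \<Rightarrow> bool" where
  "distinct_residues (a, b, c, d) \<longleftrightarrow> distinct [a mod 4, b mod 4, c mod 4, d mod 4]"

lemma distinct_residues_step: "distinct_residues x \<Longrightarrow> distinct_residues (step x s)"
  by (cases x; cases s) auto

text \<open>For a non-integer \<open>q\<close> the floor of \<open>-q\<close> is one less than minus
  the floor of \<open>q\<close>.\<close>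

lemma div_4_swap:
  fixes a b :: int
  assumes "a mod 4 \<noteq> b mod 4"
  shows "(a - b) div 4 = - ((b - a) div 4) - 1"
  using assms by presburger

text \<open>Exchanging two adjacent positions permutes the summands of the other pairs. The summand
  of the exchanged pair goes from the absolute value of \<open>q\<close> to that of
  \<open>-q - 1\<close>, or of \<open>1 - q\<close> for \<open>gen_p\<close>, and the sign of this
  change records the ascent.\<close>

lemma inversions_step:
  assumes "distinct_residues x"
  shows "inversions (step x s) = inversions x + (if ascent x s then 1 else -1)"
proof -
  obtain a b c d where x: "x = (a, b, c, d)" by (cases x)
  have ne: "a mod 4 \<noteq> b mod 4" "a mod 4 \<noteq> c mod 4" "a mod 4 \<noteq> d mod 4"
    "b mod 4 \<noteq> c mod 4" "b mod 4 \<noteq> d mod 4" "c mod 4 \<noteq> d mod 4"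
    using assms by (auto simp: x)
  show ?thesis
  proof (cases s)
    case gen_p
    \<comment> \<open>Each difference is written with its multiples of 4 split off; these then
      combine with the \<open>-1\<close> of \<open>div_4_swap\<close>.\<close>
    have shifts: "b - (d - 4) = (b - d) + 4" "c - (d - 4) = (c - d) + 4"
      "a + 4 - (d - 4) = ((a - d) + 4) + 4" "a + 4 - b = (a - b) + 4" "a + 4 - c = (a - c) + 4"
      by simp_all
    have add_4_div: "(z + 4) div 4 = z div 4 + 1" for z :: int
      by simp
    have pairs: "(b - (d - 4)) div 4 = - ((d - b) div 4)" "(c - (d - 4)) div 4 = - ((d - c) div 4)"
      "(a + 4 - (d - 4)) div 4 = 1 - (d - a) div 4"
      "(a + 4 - b) div 4 = - ((b - a) div 4)" "(a + 4 - c) div 4 = - ((c - a) div 4)"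
      unfolding shifts add_4_div
      using ne div_4_swap[of b d] div_4_swap[of c d] div_4_swap[of a d]
        div_4_swap[of a b] div_4_swap[of a c] by simp_all
    have "d - 4 < a \<longleftrightarrow> (d - a) div 4 < 1"
      by linarith
    moreover have "\<bar>1 - q\<bar> = \<bar>q\<bar> + (if q < 1 then 1 else - 1)" for q :: int
      by simp
    ultimately show ?thesis
      unfolding x gen_p step.simps inversions.simps ascent.simps pairs abs_minus_cancel by simp
  next
    case gen_r
    have "a < b \<longleftrightarrow> 0 \<le> (b - a) div 4"
      using ne(1) by (auto simp: pos_imp_zdiv_nonneg_iff order_less_le)
    then show ?thesis using gen_r div_4_swap[of a b] ne by (auto simp: x)
  next
    case gen_s
    have "b < c \<longleftrightarrow> 0 \<le> (c - b) div 4"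
      using ne(4) by (auto simp: pos_imp_zdiv_nonneg_iff order_less_le)
    then show ?thesis using gen_s div_4_swap[of b c] ne by (auto simp: x)
  next
    case gen_t
    have "c < d \<longleftrightarrow> 0 \<le> (d - c) div 4"
      using ne(6) by (auto simp: pos_imp_zdiv_nonneg_iff order_less_le)
    then show ?thesis using gen_t div_4_swap[of c d] ne by (auto simp: x)
  qed
qed

section \<open>Ascending words are reduced\<close>

fun ascending :: "window \<Rightarrow> a3_gen list \<Rightarrow> bool" where
  "ascending x [] \<longleftrightarrow> True"
| "ascending x (s # v) \<longleftrightarrow> ascent x s \<and> ascending (step x s) v"

lemma ascending_append [simp]:
  "ascending x (u @ v) \<longleftrightarrow> ascending x u \<and> ascending (act x u) v"
  by (induction u arbitrary: x) simp_all

lemma inversions_act_le: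
  "distinct_residues x \<Longrightarrow> inversions (act x v) \<le> inversions x + length v"
proof (induction v arbitrary: x)
  case (Cons s v)
  then show ?case
    using Cons.IH[of "step x s"] inversions_step[of x s]
    by (auto simp: distinct_residues_step split: if_splits)
qed simp

lemma inversions_act_ascending:
  "distinct_residues x \<Longrightarrow> ascending x v \<Longrightarrow> inversions (act x v) = inversions x + length v"
proof (induction v arbitrary: x)
  case (Cons s v)
  then show ?case
    using Cons.IH[of "step x s"] inversions_step[of x s]
    by (auto simp: distinct_residues_step)
qed simp

abbreviation id_window :: window where
  "id_window \<equiv> (1, 2, 3, 4)"

text \<open>The identity window has no inversions and each letter adds at most one; this is applied
  to a shortest word for the element.\<close>

lemma inversions_le_cox_length:
  "inversions (act id_window v) \<le> cox_length affine_A3 (word_elt affine_A3 v)"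
proof -
  obtain u where u: "length u = cox_length affine_A3 (word_elt affine_A3 v)"
    "(u, v) \<in> coxeter_rel affine_A3"
    by (rule cox_length_attained)
  show ?thesis
    using inversions_act_le[of id_window u] act_cong[OF u(2)] u(1) by simp
qed

text \<open>The length of an ascending word equals its inversion number, which is squeezed between
  the two bounds for \<open>cox_length\<close>.\<close>

lemma reduced_if_ascending:
  assumes "ascending id_window v"
  shows "reduced affine_A3 v"
  using inversions_act_ascending[of id_window v] inversions_le_cox_length[of v]
    cox_length_le[of affine_A3 v] assms
  by (simp add: reduced_def)

section \<open>Words of the standard language\<close>

text \<open>These three facts form the invariant for building standard words block by block: the
  next block depends on \<open>u\<close> only through the window reached.\<close>

definition standard_at :: "window \<Rightarrow> a3_gen list \<Rightarrow> bool" where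
  "standard_at x u \<longleftrightarrow>
    u \<in> standard_language affine_A3 \<and> ascending id_window u \<and> act id_window u = x"

text \<open>Letters outside \<open>w\<close> extend \<open>u @ w\<close> to an ascending, hence
  reduced word, so they are no descents. Letters of \<open>w\<close> can be brought to its end, so
  they are. Thus the descent set is \<open>set w\<close>, and \<open>F\<close> exhibits
  \<open>w\<close> as the longest element of the group it generates.\<close>

lemma standard_at_append:
  assumes u: "standard_at x u" and asc: "ascending x w" and "w \<noteq> []"
    and up: "\<And>i. i \<notin> set w \<Longrightarrow> ascent (act x w) i"
    and down: "\<And>s. s \<in> set w \<Longrightarrow>
      \<exists>w'. (w, w' @ [s]) \<in> coxeter_rel affine_A3 \<and> length w = Suc (length w')"
    and F: "[] \<in> F" "w \<in> F" "\<And>f. f \<in> F \<Longrightarrow> f \<noteq> w \<Longrightarrow> length f < length w"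
    and closed: "\<And>f s. f \<in> F \<Longrightarrow> s \<in> set w \<Longrightarrow> \<exists>f'\<in>F. (f @ [s], f') \<in> coxeter_rel affine_A3"
  shows "standard_at (act x w) (u @ w)"
proof -
  have asc_uw: "ascending id_window (u @ w)" using u asc by (simp add: standard_at_def)
  then have red: "reduced affine_A3 (u @ w)" by (rule reduced_if_ascending)
  have "i \<in> right_descents affine_A3 (word_elt affine_A3 (u @ w)) \<longleftrightarrow> i \<in> set w" for i
  proof
    assume i: "i \<in> set w"
    obtain w' where "(w, w' @ [i]) \<in> coxeter_rel affine_A3" "length w = Suc (length w')"
      using down[OF i] by blast
    then show "i \<in> right_descents affine_A3 (word_elt affine_A3 (u @ w))"
      using right_descent_if_final_letter[OF red, of "u @ w'" i]
        coxeter_rel_context[of w "w' @ [i]" affine_A3 u "[]"] by simp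
  next
    assume i: "i \<in> right_descents affine_A3 (word_elt affine_A3 (u @ w))"
    show "i \<in> set w"
    proof (rule ccontr)
      assume "i \<notin> set w"
      then have "ascending id_window ((u @ w) @ [i])"
        using up asc_uw u by (simp add: standard_at_def)
      then show False
        using i not_right_descent_if_reduced reduced_if_ascending by blast
    qed
  qed
  then have descents: "right_descents affine_A3 (word_elt affine_A3 (u @ w)) = set w" by blast
  have "longest_suffix affine_A3 (word_elt affine_A3 (u @ w)) = word_elt affine_A3 w"
    by (rule longest_suffix_eqI[where F = F])
      (use F closed reduced_suffix[OF red] in \<open>auto simp: descents\<close>)
  then show ?thesis
    using u asc_uw red \<open>w \<noteq> []\<close> standard_language_append
    by (auto simp: standard_at_def)
qed

text \<open>Three kinds of block occur, with longest elements \<open>s\<close>, \<open>st\<close>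
  and \<open>sts\<close>. In each case \<open>F\<close> lists one word per element of the subgroup
  generated by the block, namely 2, 4 and 6 words.\<close>

lemma standard_at_single:
  assumes "standard_at x u" "ascent x s" "\<forall>i. i \<noteq> s \<longrightarrow> ascent (step x s) i"
  shows "standard_at (step x s) (u @ [s])"
proof -
  have "standard_at (act x [s]) (u @ [s])"
    by (rule standard_at_append[where F = "{[], [s]}"])
      (use assms coxeter_rel_square coxeter_rel.refl in force)+
  then show ?thesis by simp
qed

lemma standard_at_comm:
  assumes "standard_at x u" "ascending x [s, t]" "s \<noteq> t" "affine_A3 s t = 2"
    and "\<forall>i. i \<noteq> s \<longrightarrow> i \<noteq> t \<longrightarrow> ascent (act x [s, t]) i"
  shows "standard_at (act x [s, t]) (u @ [s, t])"
proof (rule standard_at_append[where F = "{[], [s], [t], [s, t]}"])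
  let ?R = "coxeter_rel affine_A3"
  have comm: "([s, t], [t, s]) \<in> ?R" using assms by (intro coxeter_rel_comm)
  show "\<exists>w'. ([s, t], w' @ [i]) \<in> ?R \<and> length [s, t] = Suc (length w')" if "i \<in> set [s, t]" for i
  proof (cases "i = s")
    case True
    then show ?thesis using comm by (intro exI[of _ "[t]"]) simp
  next
    case False
    then show ?thesis using that coxeter_rel.refl by (intro exI[of _ "[s]"]) auto
  qed
  have "([s, t] @ [s], [t]) \<in> ?R"
    using coxeter_rel_context[OF comm, of "[]" "[s]"] coxeter_rel_context[OF coxeter_rel_square[of s affine_A3], of "[t]" "[]"]
    by (auto intro: coxeter_rel.trans)
  moreover have "([s, t] @ [t], [s]) \<in> ?R"
    using coxeter_rel_context[OF coxeter_rel_square[of t affine_A3], of "[s]" "[]"] by simp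
  ultimately show "\<exists>f'\<in>{[], [s], [t], [s, t]}. (f @ [i], f') \<in> ?R"
    if "f \<in> {[], [s], [t], [s, t]}" "i \<in> set [s, t]" for f i
    using that coxeter_rel_square[of _ affine_A3] coxeter_rel.refl[of _ affine_A3]
      coxeter_rel.sym[OF comm] by auto
qed (use assms in auto)

lemma standard_at_braid:
  assumes "standard_at x u" "ascending x [s, t, s]" "s \<noteq> t" "affine_A3 s t = 3"
    and "\<forall>i. i \<noteq> s \<longrightarrow> i \<noteq> t \<longrightarrow> ascent (act x [s, t, s]) i"
  shows "standard_at (act x [s, t, s]) (u @ [s, t, s])"
proof (rule standard_at_append[where F = "{[], [s], [t], [s, t], [t, s], [s, t, s]}"])
  let ?R = "coxeter_rel affine_A3"
  have braid: "([s, t, s], [t, s, t]) \<in> ?R" using assms by (intro coxeter_rel_braid3)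
  show "\<exists>w'. ([s, t, s], w' @ [i]) \<in> ?R \<and> length [s, t, s] = Suc (length w')"
    if "i \<in> set [s, t, s]" for i
  proof (cases "i = s")
    case True
    then show ?thesis using coxeter_rel.refl by (intro exI[of _ "[s, t]"]) auto
  next
    case False
    then show ?thesis using that braid by (intro exI[of _ "[t, s]"]) auto
  qed
  have "([s, t, s] @ [t], [t, s]) \<in> ?R"
    using coxeter_rel_context[OF braid, of "[]" "[t]"]
      coxeter_rel_context[OF coxeter_rel_square[of t affine_A3], of "[t, s]" "[]"]
    by (auto intro: coxeter_rel.trans)
  moreover have "([i, j] @ [j], [i]) \<in> ?R" for i j
    using coxeter_rel_context[OF coxeter_rel_square[of j affine_A3], of "[i]" "[]"] by simp
  moreover have "([s, t, s] @ [s], [s, t]) \<in> ?R"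
    using coxeter_rel_context[OF coxeter_rel_square[of s affine_A3], of "[s, t]" "[]"] by simp
  ultimately show "\<exists>f'\<in>{[], [s], [t], [s, t], [t, s], [s, t, s]}. (f @ [i], f') \<in> ?R"
    if "f \<in> {[], [s], [t], [s, t], [t, s], [s, t, s]}" "i \<in> set [s, t, s]" for f i
    using that coxeter_rel_square[of _ affine_A3] coxeter_rel.refl[of _ affine_A3]
      coxeter_rel.sym[OF braid] by auto
qed (use assms in auto)

lemma standard_at_Nil: "standard_at id_window []"
  by (simp add: standard_at_def standard_language.empty)

section \<open>The translations and their block decompositions\<close>

lemma affine_A3_values:
  "affine_A3 gen_r gen_t = 2" "affine_A3 gen_p gen_s = 2" "affine_A3 gen_s gen_p = 2"
  "affine_A3 gen_s gen_t = 3" "affine_A3 gen_r gen_p = 3" "affine_A3 gen_s gen_r = 3"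
  "affine_A3 gen_r gen_s = 3" "affine_A3 gen_p gen_r = 3" "affine_A3 gen_p gen_t = 3"
  by (simp_all add: affine_A3_def doubleton_eq_iff)

abbreviation "word_A \<equiv> [gen_r, gen_t, gen_s, gen_r, gen_t, gen_p]"
abbreviation "word_B \<equiv> [gen_r, gen_t, gen_p, gen_s]"
abbreviation "word_D \<equiv> [gen_s, gen_t, gen_s, gen_r, gen_p, gen_r]"

text \<open>These words are translations: they keep the order of the entries in the tuple and change
  them by multiples of 4.\<close>

lemma act_word_power:
  "act (a, b, c, d) (word_power word_A n) = (a - 4 * int n, b, c, d + 4 * int n)"
  "act (a, b, c, d) (word_power (word_B @ word_B) n) =
    (a - 4 * int n, b + 4 * int n, c - 4 * int n, d + 4 * int n)"
  "act (a, b, c, d) (word_power (rev word_A) n) = (a + 4 * int n, b, c, d - 4 * int n)"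
  by (induction n arbitrary: a b c d) (simp_all add: algebra_simps)

lemma all_a3_gen_iff: "(\<forall>i. P i) \<longleftrightarrow> P gen_p \<and> P gen_r \<and> P gen_s \<and> P gen_t"
  by (metis a3_gen.exhaust)

text \<open>The blocks are \<open>rt\<close>, \<open>s\<close>, \<open>rt\<close>, \<open>p\<close>.
  The inequalities on the window survive the translation, so the lemma can be iterated.\<close>

lemma standard_at_word_A:
  assumes "standard_at (a, b, c, d) u" "a < b" "b < c" "c < d" "c - 4 < b"
  shows "standard_at (a - 4, b, c, d + 4) (u @ word_A)"
proof -
  have "standard_at (b, a, d, c) (u @ [gen_r, gen_t])"
    using standard_at_comm[OF assms(1), of gen_r gen_t] assms
    by (simp add: all_a3_gen_iff affine_A3_values)
  from standard_at_single[OF this, of gen_s]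
  have "standard_at (b, d, a, c) (u @ [gen_r, gen_t, gen_s])"
    using assms by (simp add: all_a3_gen_iff)
  from standard_at_comm[OF this, of gen_r gen_t]
  have "standard_at (d, b, c, a) (u @ [gen_r, gen_t, gen_s, gen_r, gen_t])"
    using assms by (simp add: all_a3_gen_iff affine_A3_values)
  from standard_at_single[OF this, of gen_p]
  show ?thesis
    using assms by (simp add: all_a3_gen_iff)
qed

text \<open>The blocks are \<open>rt\<close> and \<open>ps\<close>. A single \<open>word_B\<close>
  also interchanges entries; its square is a pure translation.\<close>

lemma standard_at_word_B:
  assumes "standard_at (a, b, c, d) u" "a < b" "c < d" "c - 4 < b" "a < d"
  shows "standard_at (c - 4, d, a, b + 4) (u @ word_B)"
proof -
  have "standard_at (b, a, d, c) (u @ [gen_r, gen_t])"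
    using standard_at_comm[OF assms(1), of gen_r gen_t] assms
    by (simp add: all_a3_gen_iff affine_A3_values)
  from standard_at_comm[OF this, of gen_p gen_s]
  show ?thesis
    using assms by (simp add: all_a3_gen_iff affine_A3_values)
qed

text \<open>The blocks are \<open>sts\<close> and \<open>rpr\<close>. As the conjugate of
  \<open>word_A\<close> by \<open>gen_r\<close>, this word translates the second entry in place of
  the first.\<close>

lemma standard_at_word_D:
  assumes "standard_at (a, b, c, d) u" "b < c" "c < d" "a < d" "b - 4 < a"
  shows "standard_at (a, b - 4, c, d + 4) (u @ word_D)"
proof -
  have "standard_at (a, d, c, b) (u @ [gen_s, gen_t, gen_s])"
    using standard_at_braid[OF assms(1), of gen_s gen_t] assms
    by (simp add: all_a3_gen_iff affine_A3_values)
  from standard_at_braid[OF this, of gen_r gen_p]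
  show ?thesis
    using assms by (simp add: all_a3_gen_iff affine_A3_values)
qed

lemma standard_at_power_A:
  "standard_at (1 - 4 * int n, 2, 3, 4 + 4 * int n) (word_power word_A n)"
proof (induction n)
  case (Suc n)
  from standard_at_word_A[OF this] show ?case
    unfolding word_power_Suc_right by (simp add: algebra_simps)
qed (simp add: standard_at_Nil)

lemma standard_at_power_BB:
  assumes "standard_at (a, b, c, d) u" "a < b" "c < d" "c - 4 < b" "a < d"
  shows "standard_at (a - 4 * int n, b + 4 * int n, c - 4 * int n, d + 4 * int n)
    (u @ word_power (word_B @ word_B) n)"
proof (induction n)
  case (Suc n)
  from standard_at_word_B[OF this]
  have "standard_at (c - 4 * int n - 4, d + 4 * int n, a - 4 * int n, b + 4 * int n + 4)
      ((u @ word_power (word_B @ word_B) n) @ word_B)"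
    using assms by simp
  from standard_at_word_B[OF this] show ?case
    using assms unfolding word_power_Suc_right by (simp add: algebra_simps)
qed (simp add: assms)

lemma standard_at_power_D:
  assumes "standard_at (a, b, c, d) u" "b < c" "c < d" "a < d" "b - 4 < a"
  shows "standard_at (a, b - 4 * int n, c, d + 4 * int n) (u @ word_power word_D n)"
proof (induction n)
  case (Suc n)
  from standard_at_word_D[OF this] show ?case
    using assms unfolding word_power_Suc_right by (simp add: algebra_simps)
qed (simp add: assms)

lemma standard_at_first:
  "standard_at (1 - 4 * int n - 4 * int k, 2 + 4 * int k, 3 - 4 * int k, 4 + 4 * int n + 4 * int k)
    (word_power word_A n @ word_power (word_B @ word_B) k)"
  by (rule standard_at_power_BB[OF standard_at_power_A]) simp_all

lemma standard_at_second:
  "standard_at (2 + 4 * int k, 1 - 4 * int k - 4 * int n, 3 - 4 * int k, 4 + 4 * int k + 4 * int n)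
    (word_power (word_B @ word_B) k @ [gen_r] @ word_power word_D n)"
proof -
  have "standard_at (1 - 4 * int k, 2 + 4 * int k, 3 - 4 * int k, 4 + 4 * int k)
      (word_power (word_B @ word_B) k)"
    using standard_at_power_BB[OF standard_at_Nil, of k] by simp
  \<comment> \<open>Here \<open>gen_r\<close> is a block of its own: exchanging the first two
    entries leaves ascents at the three other generators and the inequalities required for
    \<open>word_D\<close>.\<close>
  from standard_at_single[OF this, of gen_r]
  have "standard_at (2 + 4 * int k, 1 - 4 * int k, 3 - 4 * int k, 4 + 4 * int k)
      (word_power (word_B @ word_B) k @ [gen_r])"
    by (simp add: all_a3_gen_iff)
  from standard_at_power_D[OF this, of n] show ?thesis by simp
qed

section \<open>Two words for neighbouring elements\<close>

text \<open>One commutation and one braid move suffice: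
  \<open>rtsrtpr = rtstrpr = rstsrpr\<close>.\<close>

lemma rel_word_A_gen_r: "(word_A @ [gen_r], [gen_r] @ word_D) \<in> coxeter_rel affine_A3"
proof -
  let ?R = "coxeter_rel affine_A3"
  have rt: "([gen_r, gen_t], [gen_t, gen_r]) \<in> ?R"
    by (simp add: coxeter_rel_comm affine_A3_values)
  have ts: "([gen_t, gen_s, gen_t], [gen_s, gen_t, gen_s]) \<in> ?R"
    by (rule coxeter_rel.sym) (simp add: coxeter_rel_braid3 affine_A3_values)
  have "(word_A @ [gen_r], [gen_r, gen_t, gen_s, gen_t, gen_r, gen_p, gen_r]) \<in> ?R"
    using coxeter_rel_context[OF rt, of "[gen_r, gen_t, gen_s]" "[gen_p, gen_r]"] by simp
  moreover have "([gen_r, gen_t, gen_s, gen_t, gen_r, gen_p, gen_r], [gen_r] @ word_D) \<in> ?R"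
    using coxeter_rel_context[OF ts, of "[gen_r]" "[gen_r, gen_p, gen_r]"] by simp
  ultimately show ?thesis by (rule coxeter_rel.trans)
qed

text \<open>
  Here \<open>x\<close> is a neighbour of the commuting generators \<open>gen_r\<close> and \<open>gen_t\<close>; both words are
  reduced expressions of the longest element of the symmetric group generated by these three.
\<close>

lemma rel_longest_element:
  assumes "x = gen_p \<or> x = gen_s"
  shows "([x, gen_r, gen_t, x, gen_r, gen_t], [gen_r, gen_t, x, gen_r, gen_t, x])
    \<in> coxeter_rel affine_A3"
proof -
  let ?R = "coxeter_rel affine_A3"
  note [trans] = coxeter_rel.trans
  have rt: "([gen_r, gen_t], [gen_t, gen_r]) \<in> ?R"
    by (simp add: coxeter_rel_comm affine_A3_values)
  have x: "x \<noteq> gen_r" "x \<noteq> gen_t" "affine_A3 x gen_r = 3" "affine_A3 x gen_t = 3"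
    using assms by (auto simp: affine_A3_values)
  have xr: "([x, gen_r, x], [gen_r, x, gen_r]) \<in> ?R" and xt: "([x, gen_t, x], [gen_t, x, gen_t]) \<in> ?R"
    using x by (simp_all add: coxeter_rel_braid3)
  have "([x, gen_r, gen_t, x, gen_r, gen_t], [x, gen_r, gen_t, x, gen_t, gen_r]) \<in> ?R"
    using coxeter_rel_context[OF rt, of "[x, gen_r, gen_t, x]" "[]"] by simp
  also have "([x, gen_r, gen_t, x, gen_t, gen_r], [x, gen_r, x, gen_t, x, gen_r]) \<in> ?R"
    using coxeter_rel_context[OF coxeter_rel.sym[OF xt], of "[x, gen_r]" "[gen_r]"] by simp
  also have "([x, gen_r, x, gen_t, x, gen_r], [gen_r, x, gen_r, gen_t, x, gen_r]) \<in> ?R"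
    using coxeter_rel_context[OF xr, of "[]" "[gen_t, x, gen_r]"] by simp
  also have "([gen_r, x, gen_r, gen_t, x, gen_r], [gen_r, x, gen_t, gen_r, x, gen_r]) \<in> ?R"
    using coxeter_rel_context[OF rt, of "[gen_r, x]" "[x, gen_r]"] by simp
  also have "([gen_r, x, gen_t, gen_r, x, gen_r], [gen_r, x, gen_t, x, gen_r, x]) \<in> ?R"
    using coxeter_rel_context[OF coxeter_rel.sym[OF xr], of "[gen_r, x, gen_t]" "[]"] by simp
  also have "([gen_r, x, gen_t, x, gen_r, x], [gen_r, gen_t, x, gen_t, gen_r, x]) \<in> ?R"
    using coxeter_rel_context[OF xt, of "[gen_r]" "[gen_r, x]"] by simp
  also have "([gen_r, gen_t, x, gen_t, gen_r, x], [gen_r, gen_t, x, gen_r, gen_t, x]) \<in> ?R"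
    using coxeter_rel_context[OF coxeter_rel.sym[OF rt], of "[gen_r, gen_t, x]" "[x]"] by simp
  finally show ?thesis .
qed

text \<open>Replacing \<open>rtprtp\<close> by \<open>prtprt\<close> carries a \<open>p\<close>
  leftwards next to an \<open>s\<close>, and commuting them completes the first
  \<open>word_B\<close>. The same with \<open>rtsrts\<close> completes the second and leaves
  \<open>word_A\<close> at the end.\<close>

lemma rel_word_A_word_BB:
  "(word_A @ word_B @ word_B, (word_B @ word_B) @ word_A) \<in> coxeter_rel affine_A3"
proof -
  let ?R = "coxeter_rel affine_A3"
  note [trans] = coxeter_rel.trans
  have sp: "([gen_s, gen_p], [gen_p, gen_s]) \<in> ?R"
    by (simp add: coxeter_rel_comm affine_A3_values)
  have "(word_A @ word_B @ word_B,
      [gen_r, gen_t, gen_s, gen_p, gen_r, gen_t, gen_p, gen_r, gen_t, gen_s] @ word_B) \<in> ?R"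
    using coxeter_rel_context[OF coxeter_rel.sym[OF rel_longest_element[of gen_p]],
        of "[gen_r, gen_t, gen_s]" "gen_s # word_B"] by simp
  also have "([gen_r, gen_t, gen_s, gen_p, gen_r, gen_t, gen_p, gen_r, gen_t, gen_s] @ word_B,
      word_B @ [gen_r, gen_t, gen_p, gen_r, gen_t, gen_s, gen_r, gen_t, gen_p, gen_s]) \<in> ?R"
    using coxeter_rel_context[OF sp, of "[gen_r, gen_t]"
        "[gen_r, gen_t, gen_p, gen_r, gen_t, gen_s, gen_r, gen_t, gen_p, gen_s]"] by simp
  also have "(word_B @ [gen_r, gen_t, gen_p, gen_r, gen_t, gen_s, gen_r, gen_t, gen_p, gen_s],
      word_B @ [gen_r, gen_t, gen_p, gen_r, gen_t, gen_s, gen_r, gen_t, gen_s, gen_p]) \<in> ?R"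
    using coxeter_rel_context[OF coxeter_rel.sym[OF sp],
        of "word_B @ [gen_r, gen_t, gen_p, gen_r, gen_t, gen_s, gen_r, gen_t]" "[]"] by simp
  also have "(word_B @ [gen_r, gen_t, gen_p, gen_r, gen_t, gen_s, gen_r, gen_t, gen_s, gen_p],
      (word_B @ word_B) @ word_A) \<in> ?R"
    using coxeter_rel_context[OF coxeter_rel.sym[OF rel_longest_element[of gen_s]],
        of "word_B @ [gen_r, gen_t, gen_p]" "[gen_p]"] by simp
  finally show ?thesis .
qed

lemma rel_first_second:
  "((word_power word_A n @ word_power (word_B @ word_B) k) @ [gen_r],
    word_power (word_B @ word_B) k @ [gen_r] @ word_power word_D n) \<in> coxeter_rel affine_A3"
proof (rule coxeter_rel.trans)
  show "((word_power word_A n @ word_power (word_B @ word_B) k) @ [gen_r],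
      word_power (word_B @ word_B) k @ word_power word_A n @ [gen_r]) \<in> coxeter_rel affine_A3"
    using coxeter_rel_context[OF coxeter_rel_power_comm, OF rel_word_A_word_BB,
        of "[]" n k "[gen_r]"] by simp
  show "(word_power (word_B @ word_B) k @ word_power word_A n @ [gen_r],
      word_power (word_B @ word_B) k @ [gen_r] @ word_power word_D n) \<in> coxeter_rel affine_A3"
    using coxeter_rel_context[OF coxeter_rel_power_left[OF rel_word_A_gen_r],
        of "word_power (word_B @ word_B) k" n "[]"] by simp
qed

lemma inv_word_elt: "inv\<^bsub>coxeter_group m\<^esub> (word_elt m v) = word_elt m (rev v)"
  by (rule group.inv_equality[OF group_coxeter_group])
    (auto simp: mult_word_elt one_coxeter_group word_elt_eq_iff rev_word_inverse
      carrier_coxeter_group)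

lemma rev_word_power: "rev (word_power v n) = word_power (rev v) n"
  by (simp add: rev_concat)

text \<open>
  The lengths 24 of \<open>word_A\<close> to the fourth and of \<open>word_B\<close> to the sixth agree, so the prefixes
  of length \<open>24 * n\<close> are these pure powers, which translate in different directions.
\<close>

lemma prefixes_diverge:
  "6 * n \<le> cox_length affine_A3
    (word_elt affine_A3 (rev (word_power word_A (4 * n)) @ word_power (word_B @ word_B) (3 * n)))"
proof -
  have "act id_window (rev (word_power word_A (4 * n)) @ word_power (word_B @ word_B) (3 * n)) =
      (1 + 4 * int n, 2 + 12 * int n, 3 - 12 * int n, 4 - 4 * int n)"
    unfolding rev_word_power act_simps act_word_power by simp
  \<comment> \<open>\<open>word_A\<close> fixes the second and third entries, while the square of
    \<open>word_B\<close> drives them apart, so their summand alone detects the divergence.\<close>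
  moreover have "\<bar>(c - b) div 4\<bar> \<le> inversions (a, b, c, d)" for a b c d
    by (simp add: add_nonneg_nonneg)
  moreover have "\<bar>(3 - 12 * int n - (2 + 12 * int n)) div 4\<bar> = 6 * int n"
    by presburger
  ultimately have "6 * int n \<le> inversions
      (act id_window (rev (word_power word_A (4 * n)) @ word_power (word_B @ word_B) (3 * n)))"
    by metis
  also note inversions_le_cox_length
  finally show ?thesis by simp
qed

theorem theorem1p4:
  shows "\<not> (\<exists>C::real. C > 0 \<and>
    (\<forall>a::a3_gen.
     \<forall>g \<in> carrier (coxeter_group affine_A3).
     \<forall>g' \<in> carrier (coxeter_group affine_A3).
       g' = g \<otimes>\<^bsub>coxeter_group affine_A3\<^esub> word_elt affine_A3 [a] \<longrightarrow>
       (\<forall>v \<in> standard_language affine_A3. \<forall>v' \<in> standard_language affine_A3.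
          word_elt affine_A3 v = g \<longrightarrow> word_elt affine_A3 v' = g' \<longrightarrow>
          (\<forall>i::nat. i \<ge> 1 \<longrightarrow>
             real (cox_length affine_A3
               (inv\<^bsub>coxeter_group affine_A3\<^esub> (word_elt affine_A3 (take i v))
                  \<otimes>\<^bsub>coxeter_group affine_A3\<^esub> word_elt affine_A3 (take i v'))) \<le> C))))"
proof
  let ?G = "coxeter_group affine_A3"
  let ?bounded_by = "\<lambda>C::real. \<forall>a::a3_gen. \<forall>g \<in> carrier ?G. \<forall>g' \<in> carrier ?G.
       g' = g \<otimes>\<^bsub>?G\<^esub> word_elt affine_A3 [a] \<longrightarrow>
       (\<forall>v \<in> standard_language affine_A3. \<forall>v' \<in> standard_language affine_A3.
          word_elt affine_A3 v = g \<longrightarrow> word_elt affine_A3 v' = g' \<longrightarrow>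
          (\<forall>i::nat. i \<ge> 1 \<longrightarrow>
             real (cox_length affine_A3
               (inv\<^bsub>?G\<^esub> (word_elt affine_A3 (take i v))
                  \<otimes>\<^bsub>?G\<^esub> word_elt affine_A3 (take i v'))) \<le> C))"
  assume "\<exists>C. C > 0 \<and> ?bounded_by C"
  then obtain C :: real where bounded: "?bounded_by C" by (elim exE conjE)
  have C: "real (cox_length affine_A3 (inv\<^bsub>?G\<^esub> (word_elt affine_A3 (take i v))
       \<otimes>\<^bsub>?G\<^esub> word_elt affine_A3 (take i v'))) \<le> C"
    if "v \<in> standard_language affine_A3" "v' \<in> standard_language affine_A3"
      "word_elt affine_A3 v' = word_elt affine_A3 v \<otimes>\<^bsub>?G\<^esub> word_elt affine_A3 [a]" "i \<ge> 1"
    for a v v' i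
    by (rule bounded[rule_format, where a = a and g = "word_elt affine_A3 v"
          and g' = "word_elt affine_A3 v'"])
      (use that in \<open>auto simp: carrier_coxeter_group mult_word_elt\<close>)
  obtain n :: nat where n: "C < real n" using reals_Archimedean2 by blast
  \<comment> \<open>The successor makes \<open>24 * N\<close> positive, as the bound is assumed only
    for \<open>i \<ge> 1\<close>.\<close>
  define N where "N = Suc n"
  let ?v = "word_power word_A (4 * N) @ word_power (word_B @ word_B) (3 * N)"
  let ?v' = "word_power (word_B @ word_B) (3 * N) @ [gen_r] @ word_power word_D (4 * N)"
  have v: "?v \<in> standard_language affine_A3" "?v' \<in> standard_language affine_A3"
    using standard_at_first[of "4 * N" "3 * N"] standard_at_second[of "3 * N" "4 * N"]
    unfolding standard_at_def by blast+
  have "word_elt affine_A3 ?v' = word_elt affine_A3 ?v \<otimes>\<^bsub>?G\<^esub> word_elt affine_A3 [gen_r]"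
    unfolding mult_word_elt word_elt_eq_iff by (rule coxeter_rel.sym, rule rel_first_second)
  note le_C = C[OF v this, of "24 * N"]
  have takes: "take (24 * N) ?v = word_power word_A (4 * N)"
    "take (24 * N) ?v' = word_power (word_B @ word_B) (3 * N)"
    by (rule take_word_power, simp)+
  have "real (6 * N) \<le> real (cox_length affine_A3 (inv\<^bsub>?G\<^esub> (word_elt affine_A3 (take (24 * N) ?v))
      \<otimes>\<^bsub>?G\<^esub> word_elt affine_A3 (take (24 * N) ?v')))"
    unfolding takes inv_word_elt mult_word_elt of_nat_le_iff by (rule prefixes_diverge)
  also have "\<dots> \<le> C" by (rule le_C) (simp add: N_def)
  finally show False using n by (simp add: N_def)
qed

end
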